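(* Let $n\ge 5$, let $q=(a,b,p_5,\dots,p_{n-1})\in\mathbb{R}^{n-3}$, and let $R_q$, $\gamma(q)$ and $\mathcal P_n$ be as defined in the context. For $p_n\in\mathbb{R}$ let $P$ be the monic degree-$n$ polynomial whose roots have power sums $(0,1,q,p_n)$. Suppose that $R_q'$ has $n-1$ simple real zeros $w_1<\dots<w_{n-1}$, with critical values $v_j=R_q(w_j)$. Let $L$ be the largest $v_j$ at a local minimum of $R_q$ and $U$ the smallest $v_j$ at a local maximum of $R_q$, and set $r_j=n\{v_j-\gamma(q)\}$, $r_-=n\{L-\gamma(q)\}$, $r_+=n\{U-\gamma(q)\}$. Then: (i) $(0,1,q,p_n)\in\mathcal P_n$ if and only if $p_n\in[r_-,r_+]$; this interval is empty if $L>U$. (If, instead of the hypothesis above, $R_q'$ has fewer than $n-1$ real zeros, counted with multiplicity, then the fibre $\{p_n\in\mathbb{R}:(0,1,q,p_n)\in\mathcal P_n\}$ is empty.) (ii) $|\mathrm{Disc}(P)|=n\prod_{j=1}^{n-1}|p_n-r_j|$; (iii) if $r_-<r_+$, then, writing $I$ for the set of the $n-3$ indices $j$ with $r_j\notin\{r_-,r_+\}$ and $y_j=(r_+-r_-)/(r_j-r_-)$ for $j\in I$, $$\int_{r_-}^{r_+}\frac{dp_n}{\mathrm{Disc}(P)^{1/2}}=\frac{\pi\,F_D^{(n-3)}\bigl(\tfrac12;\tfrac12,\dots,\tfrac12;1;y\bigr)}{\sqrt n\,\prod_{j\in I}|r_--r_j|^{1/2}},\qquad y=(y_j)_{j\in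 I}.$$
   Context: A monic polynomial $P(z)=\prod_{i=1}^n(z-u_i)=\sum_{j=0}^n(-1)^je_jz^{n-j}$ (with $e_0=1$) is determined by the power sums $p_r=\sum_i u_i^r$, $1\le r\le n$, of its roots through Newton's identities $p_r=\sum_{j=1}^{r-1}(-1)^{j-1}e_jp_{r-j}+(-1)^{r-1}re_r$. $\mathcal P_n\subset\mathbb{R}^n$ is the set of $p=(p_1,\dots,p_n)\in\mathbb{R}^n$ for which $P$ has $n$ real roots (counted with multiplicity), and $\mathrm{Disc}(P)=\prod_{i<j}(u_i-u_j)^2$. Given $q=(a,b,p_5,\dots,p_{n-1})$, let $e_1,\dots,e_{n-1}$ be determined by Newton's identities from $(p_1,\dots,p_{n-1})=(0,1,q)$ (so $p_1=0,\ p_2=1,\ p_3=a,\ p_4=b$), and put $$R_q(z)=\sum_{j=0}^{n-1}(-1)^je_jz^{n-j},\qquad \gamma(q)=-\frac1n\sum_{j=1}^{n-1}(-1)^{j-1}e_jp_{n-j}.$$ Then $P(z)=R_q(z)-t$ with $t=p_n/n+\gamma(q)$. The Lauricella function $F_D^{(m)}$ is understood through Euler's integral, for $c>a>0$ and real $y_j<1$: $$F_D^{(m)}(a;b_1,\dots,b_m;c;y_1,\dots,y_m)=\frac{\Gamma(c)}{\Gamma(a)\Gamma(c-a)}\int_0^1x^{a-1}(1-x)^{c-a-1}\prod_{j=1}^m(1-y_jx)^{-b_j}\,dx .$$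
   Formalization: In (iii) it is assumed explicitly that exactly n−3 indices j satisfy r_j ∉ {r_-, r_+}, i.e. that the values L and U are each attained at only one critical point; otherwise the integral diverges and F_D^{(n-3)} has too few arguments. *)

theory Defs
  imports
    "HOL-Analysis.Analysis"
    "HOL-Computational_Algebra.Computational_Algebra"
begin

(* A point (p_1, ..., p_n) of real n-space is a list p of length n, so that p_r is p ! (r - 1). *)

definition power_sum_of_roots :: "real poly \<Rightarrow> nat \<Rightarrow> complex" where
  "power_sum_of_roots P r = (\<Sum>u\<in>#proots (map_poly complex_of_real P). u ^ r)"

definition has_power_sums :: "real list \<Rightarrow> real poly \<Rightarrow> bool" where
  "has_power_sums p P \<longleftrightarrow> lead_coeff P = 1 \<and> degree P = length p \<and>
     (\<forall>r\<in>{1..length p}. power_sum_of_roots P r = complex_of_real (p ! (r - 1)))"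

(* Existence and uniqueness: lemmas has_power_sums_iff, power_sum_poly_eq_newton below. *)
definition power_sum_poly :: "real list \<Rightarrow> real poly" where
  "power_sum_poly p = (THE P. has_power_sums p P)"

definition real_rooted_points :: "nat \<Rightarrow> real list set" where
  "real_rooted_points n = {p. length p = n \<and> size (proots (power_sum_poly p)) = n}"

(* Newton's identity p_r = (\<Sum>j=1..<r. (-1)^(j-1) e_j p_(r-j)) + (-1)^(r-1) r e_r, solved for e_r. *)
fun newton_e :: "real list \<Rightarrow> nat \<Rightarrow> real" where
  "newton_e p r = (if r = 0 then 1 else
     (-1) ^ (r - 1) * (p ! (r - 1) - (\<Sum>j=1..<r. (-1) ^ (j - 1) * newton_e p j * p ! (r - j - 1)))
       / real r)"

declare newton_e.simps [simp del]

definition R_poly :: "nat \<Rightarrow> real list \<Rightarrow> real poly" where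
  "R_poly n q = (\<Sum>j=0..n-1. monom ((-1) ^ j * newton_e (0 # 1 # q) j) (n - j))"

definition gamma_shift :: "nat \<Rightarrow> real list \<Rightarrow> real" where
  "gamma_shift n q =
     - (1 / real n) *
       (\<Sum>j=1..n-1. (-1) ^ (j - 1) * newton_e (0 # 1 # q) j * (0 # 1 # q) ! (n - j - 1))"

definition roots_disc :: "complex list \<Rightarrow> complex" where
  "roots_disc us = (\<Prod>j<length us. \<Prod>i<j. (us ! i - us ! j)\<^sup>2)"

(* The discriminant of a monic polynomial.  It does not depend on the enumeration of the
   roots (Disc_eqI) and the product is real (of_real_Disc), so that Re loses nothing. *)
definition Disc :: "real poly \<Rightarrow> real" where
  "Disc P = Re (roots_disc (SOME us. mset us = proots (map_poly complex_of_real P)))"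

definition local_min_at :: "(real \<Rightarrow> real) \<Rightarrow> real \<Rightarrow> bool" where
  "local_min_at f x \<longleftrightarrow> (\<forall>\<^sub>F y in nhds x. f x \<le> f y)"

definition local_max_at :: "(real \<Rightarrow> real) \<Rightarrow> real \<Rightarrow> bool" where
  "local_max_at f x \<longleftrightarrow> (\<forall>\<^sub>F y in nhds x. f y \<le> f x)"

(* The m parameters b_j and the m variables y_j are indexed by a finite set J with card J = m;
   meaningful for c > a > 0 and y j < 1 for all j in J. *)
definition lauricella_FD ::
    "real \<Rightarrow> 'i set \<Rightarrow> ('i \<Rightarrow> real) \<Rightarrow> real \<Rightarrow> ('i \<Rightarrow> real) \<Rightarrow> real" where
  "lauricella_FD a J b c y = Gamma c / (Gamma a * Gamma (c - a)) *
     (LBINT x:{0..1}. x powr (a - 1) * (1 - x) powr (c - a - 1) * (\<Prod>j\<in>J. (1 - y j * x) powr (- b j)))"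


lemma newton_fps:
  fixes us :: "complex list"
  defines "E \<equiv> fps_of_poly (reflect_poly (\<Prod>u\<leftarrow>us. [:-u, 1:]))"
  shows "- fps_deriv E = E * Abs_fps (\<lambda>r. \<Sum>u\<leftarrow>us. u ^ Suc r)"
  unfolding E_def
proof (induction us)
  case Nil
  show ?case by (simp add: fps_eq_iff)
next
  case (Cons u us)
  let ?E = "fps_of_poly (reflect_poly (\<Prod>u\<leftarrow>us. [:-u, 1:]))"
  let ?S = "\<lambda>us. Abs_fps (\<lambda>r. \<Sum>u\<leftarrow>us. u ^ Suc r) :: complex fps"
  let ?l = "1 - fps_const u * fps_X :: complex fps"
  let ?G = "Abs_fps (\<lambda>r. u ^ Suc r) :: complex fps"
  have refl: "reflect_poly [:-u, 1:] = [:1, -u:]"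
    by (subst reflect_poly_pCons') (auto simp: one_pCons monom_Suc monom_0)
  have E: "fps_of_poly (reflect_poly (\<Prod>u\<leftarrow>u # us. [:-u, 1:])) = ?l * ?E"
    by (simp add: reflect_poly_mult refl fps_of_poly_mult fps_of_poly_linear' del: mult_pCons_left)
  have S: "?S (u # us) = ?G + ?S us"
    by (simp add: fps_eq_iff)
  have G: "?l * ?G = fps_const u"
  proof (rule fps_ext)
    fix k
    show "(?l * ?G) $ k = fps_const u $ k"
      by (cases k) (simp_all add: left_diff_distrib mult.assoc)
  qed
  have "- fps_deriv (?l * ?E) = ?l * (- fps_deriv ?E) + fps_const u * ?E"
    by (simp add: algebra_simps)
  also have "\<dots> = ?l * (?E * ?S us) + (?l * ?G) * ?E"
    unfolding Cons.IH G ..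
  also have "\<dots> = (?l * ?E) * ?S (u # us)"
    unfolding S by (simp add: algebra_simps)
  finally show ?case unfolding E .
qed

lemma newton_identity_complex:
  fixes Q :: "complex poly"
  assumes "lead_coeff Q = 1" and "r \<in> {1..degree Q}"
  shows "- of_nat r * coeff Q (degree Q - r) =
    (\<Sum>j<r. coeff Q (degree Q - j) * (\<Sum>u\<in>#proots Q. u ^ (r - j)))"
proof -
  obtain us where us: "mset us = proots Q"
    using ex_mset by blast
  have "Q = (\<Prod>x\<in>#proots Q. [:-x, 1:])"
    using complex_poly_decompose_multiset [of Q] assms(1) by simp
  also have "\<dots> = (\<Prod>u\<leftarrow>us. [:-u, 1:])"
    by (simp flip: us prod_mset_prod_list)
  finally have Q: "Q = (\<Prod>u\<leftarrow>us. [:-u, 1:])" .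
  have ps: "(\<Sum>u\<in>#proots Q. u ^ k) = (\<Sum>u\<leftarrow>us. u ^ k)" for k
    by (simp flip: us sum_mset_sum_list)
  obtain s where s: "r = Suc s" using assms(2) by (cases r) auto
  have "(- fps_deriv (fps_of_poly (reflect_poly Q))) $ s =
      (fps_of_poly (reflect_poly Q) * Abs_fps (\<lambda>r. \<Sum>u\<leftarrow>us. u ^ Suc r)) $ s"
    using newton_fps [of us] by (simp flip: Q)
  also have "\<dots> = (\<Sum>j=0..s. coeff (reflect_poly Q) j * (\<Sum>u\<leftarrow>us. u ^ Suc (s - j)))"
    by (simp add: fps_mult_nth)
  also have "\<dots> = (\<Sum>j<r. coeff Q (degree Q - j) * (\<Sum>u\<in>#proots Q. u ^ (r - j)))"
    unfolding ps using assms(2)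
    by (intro sum.cong) (auto simp: s coeff_reflect_poly Suc_diff_le)
  finally show ?thesis
    using assms(2) by (simp add: s coeff_reflect_poly algebra_simps)
qed

lemma newton_identity:
  assumes "lead_coeff P = 1" and "r \<in> {1..degree P}"
  shows "- of_nat r * complex_of_real (coeff P (degree P - r)) =
    (\<Sum>j<r. complex_of_real (coeff P (degree P - j)) * power_sum_of_roots P (r - j))"
proof -
  have "degree (map_poly complex_of_real P) = degree P"
    by (simp add: degree_map_poly)
  with newton_identity_complex [of "map_poly complex_of_real P" r] assms show ?thesis
    by (simp add: coeff_map_poly power_sum_of_roots_def)
qed

lemma newton_e_rec:
  assumes "r > 0"
  shows "- real r * ((-1) ^ r * newton_e p r) = (\<Sum>j<r. (-1) ^ j * newton_e p j * p ! (r - j - 1))"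
proof -
  obtain s where s: "r = Suc s" using assms by (cases r) auto
  have 0: "newton_e p 0 = 1" by (simp add: newton_e.simps)
  have "- real r * ((-1) ^ r * newton_e p r) =
      p ! (r - 1) - (\<Sum>j=1..<r. (-1) ^ (j - 1) * newton_e p j * p ! (r - j - 1))"
  proof -
    have "- real r * ((-1) ^ r * ((-1) ^ (r - 1) * x / real r)) = x" for x
      by (simp add: s field_simps flip: power_add mult.assoc)
    then show ?thesis
      using assms by (subst newton_e.simps) (simp only: less_imp_neq [symmetric] if_False)
  qed
  also have "(\<Sum>j=1..<r. (-1) ^ (j - 1) * newton_e p j * p ! (r - j - 1)) =
      - (\<Sum>j=1..<r. (-1) ^ j * newton_e p j * p ! (r - j - 1))"
    unfolding sum_negf [symmetric]
  proof (rule sum.cong)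
    fix j assume "j \<in> {1..<r}"
    then obtain i where "j = Suc i" by (cases j) auto
    then show "(-1) ^ (j - 1) * newton_e p j * p ! (r - j - 1) =
        - ((-1) ^ j * newton_e p j * p ! (r - j - 1))" by simp
  qed simp
  also have "p ! (r - 1) - - (\<Sum>j=1..<r. (-1) ^ j * newton_e p j * p ! (r - j - 1)) =
      (\<Sum>j<r. (-1) ^ j * newton_e p j * p ! (r - j - 1))"
    using assms by (simp add: lessThan_atLeast0 sum.atLeast_Suc_lessThan 0)
  finally show ?thesis .
qed

lemma has_power_sums_iff:
  "has_power_sums p P \<longleftrightarrow> P = (\<Sum>j=0..length p. monom ((-1) ^ j * newton_e p j) (length p - j))"
    (is "_ \<longleftrightarrow> P = ?N")
proof -
  define n where "n = length p"
  define c where "c r = (-1) ^ r * newton_e p r" for r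
  have c0: "c 0 = 1" by (simp add: c_def newton_e.simps)
  have rec: "- real r * c r = (\<Sum>j<r. c j * p ! (r - j - 1))" if "r > 0" for r
    using newton_e_rec [OF that] by (simp add: c_def)
  have coeffN: "coeff ?N k = (if k \<le> n then c (n - k) else 0)" for k
  proof -
    have "coeff ?N k = (\<Sum>j=0..n. if j = n - k then (if k \<le> n then c j else 0) else 0)"
      unfolding coeff_sum n_def [symmetric] by (intro sum.cong) (auto simp: c_def)
    then show ?thesis by (simp add: sum.delta)
  qed
  have degN: "degree ?N = n"
    by (rule antisym [OF degree_le le_degree]) (auto simp: coeffN c0)
  have leadN: "lead_coeff ?N = 1"
    by (simp only: degN coeffN) (simp add: c0)
  have "P = ?N" if P: "has_power_sums p P"
  proof -
    have P1: "lead_coeff P = 1" "degree P = n"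
      and P2: "\<And>r. r \<in> {1..n} \<Longrightarrow> power_sum_of_roots P r = complex_of_real (p ! (r - 1))"
      using P by (auto simp: has_power_sums_def n_def)
    have eq: "coeff P (n - r) = c r" if "r \<le> n" for r
      using that
    proof (induction r rule: less_induct)
      case (less r)
      show ?case
      proof (cases "r = 0")
        case True
        then show ?thesis using P1 c0 by simp
      next
        case False
        have "complex_of_real (- real r * coeff P (n - r)) =
            (\<Sum>j<r. complex_of_real (coeff P (n - j)) * power_sum_of_roots P (r - j))"
          using newton_identity [of P r] P1 less.prems False by simp
        also have "\<dots> = (\<Sum>j<r. complex_of_real (c j * p ! (r - j - 1)))"
        proof (rule sum.cong)
          fix j assume "j \<in> {..<r}"
          then have j: "j < r" "j \<le> n" "r - j \<in> {1..n}" using less.prems by auto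
          show "complex_of_real (coeff P (n - j)) * power_sum_of_roots P (r - j) =
              complex_of_real (c j * p ! (r - j - 1))"
            using less.IH [OF j(1,2)] P2 [OF j(3)] by simp
        qed simp
        also have "\<dots> = complex_of_real (- real r * c r)"
          using rec [of r] False by simp
        finally have "- real r * coeff P (n - r) = - real r * c r"
          by (simp only: of_real_eq_iff)
        then show ?thesis using False by simp
      qed
    qed
    show ?thesis
    proof (rule poly_eqI)
      fix k
      show "coeff P k = coeff ?N k"
      proof (cases "k \<le> n")
        case True
        then show ?thesis using eq [of "n - k"] by (simp add: coeffN)
      next
        case False
        then show ?thesis using P1 by (simp add: coeffN coeff_eq_0)
      qed
    qed
  qed
  moreover have "has_power_sums p ?N"
  proof -
    have "power_sum_of_roots ?N r = complex_of_real (p ! (r - 1))" if "r \<in> {1..n}" for r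
      using that
    proof (induction r rule: less_induct)
      case (less r)
      then obtain s where s: "r = Suc s" by (cases r) auto
      have "(\<Sum>j<r. complex_of_real (c j) * power_sum_of_roots ?N (r - j)) =
          - of_nat r * complex_of_real (c r)"
        using newton_identity [of ?N r, OF leadN] less.prems
        by (simp add: degN coeffN del: sum_subtractf)
      also have "\<dots> = complex_of_real (- real r * c r)"
        by simp
      also have "\<dots> = (\<Sum>j<r. complex_of_real (c j) * complex_of_real (p ! (r - j - 1)))"
        using less.prems by (subst rec) auto
      finally have eq: "(\<Sum>j<r. complex_of_real (c j) * power_sum_of_roots ?N (r - j)) =
          (\<Sum>j<r. complex_of_real (c j) * complex_of_real (p ! (r - j - 1)))" .
      have "(\<Sum>j<s. complex_of_real (c (Suc j)) * power_sum_of_roots ?N (s - j)) =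
          (\<Sum>j<s. complex_of_real (c (Suc j)) * complex_of_real (p ! (s - j - 1)))"
      proof (rule sum.cong)
        fix j assume j: "j \<in> {..<s}"
        with less.prems s have "s - j < r" "s - j \<in> {1..n}" by auto
        then show "complex_of_real (c (Suc j)) * power_sum_of_roots ?N (s - j) =
            complex_of_real (c (Suc j)) * complex_of_real (p ! (s - j - 1))"
          using less.IH [of "s - j"] by simp
      qed simp
      with eq show ?case
        unfolding s by (subst (asm) (1 2) sum.lessThan_Suc_shift) (simp add: c0)
    qed
    then show ?thesis
      using leadN degN by (simp add: has_power_sums_def n_def)
  qed
  ultimately show ?thesis by blast
qed

lemma power_sum_poly_eq_newton:
  "power_sum_poly p = (\<Sum>j=0..length p. monom ((-1) ^ j * newton_e p j) (length p - j))"
  unfolding power_sum_poly_def has_power_sums_iff by simp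

lemma has_power_sums_power_sum_poly: "has_power_sums p (power_sum_poly p)"
  by (simp add: has_power_sums_iff power_sum_poly_eq_newton)

lemma newton_e_append: "r \<le> length p \<Longrightarrow> newton_e (p @ p') r = newton_e p r"
proof (induction r rule: less_induct)
  case (less r)
  have "(\<Sum>j=1..<r. (-1) ^ (j - 1) * newton_e (p @ p') j * (p @ p') ! (r - j - 1)) =
      (\<Sum>j=1..<r. (-1) ^ (j - 1) * newton_e p j * p ! (r - j - 1))"
    using less by (intro sum.cong) (auto simp: nth_append)
  then show ?case
    using less.prems
    by (subst (1 2) newton_e.simps) (auto simp: nth_append)
qed

lemma power_sum_poly_eq_R_poly:
  assumes "n \<ge> 3" and "length q = n - 3"
  shows "power_sum_poly (0 # 1 # q @ [pn]) = R_poly n q - [:pn / real n + gamma_shift n q:]"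
proof -
  let ?p = "0 # 1 # q @ [pn]" and ?p' = "0 # 1 # q"
  have p: "?p = ?p' @ [pn]" by simp
  have len: "length ?p = n" "length ?p' = n - 1" using assms by auto
  obtain m where m: "n = Suc m" using assms by (cases n) auto
  have e: "newton_e ?p j = newton_e ?p' j" if "j \<le> n - 1" for j
    unfolding p using that len by (intro newton_e_append) simp
  have nth: "?p ! (n - 1) = pn"
    unfolding p using len by (subst nth_append) auto
  have nth': "?p ! (n - j - 1) = ?p' ! (n - j - 1)" if "j \<in> {1..<n}" for j
    unfolding p using that len by (subst nth_append) auto
  have sum: "(\<Sum>j=1..<n. (-1) ^ (j - 1) * newton_e ?p j * ?p ! (n - j - 1)) =
     (\<Sum>j=1..n-1. (-1) ^ (j - 1) * newton_e ?p' j * ?p' ! (n - j - 1))"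
  proof (rule sum.cong)
    fix j assume "j \<in> {1..n-1}"
    then have "j \<in> {1..<n}" "j \<le> n - 1" using m by auto
    then show "(-1) ^ (j - 1) * newton_e ?p j * ?p ! (n - j - 1) =
        (-1) ^ (j - 1) * newton_e ?p' j * ?p' ! (n - j - 1)"
      by (simp only: e nth')
  qed (use m in auto)
  have sgn: "(-1) ^ n * ((-1) ^ (n - 1) * x) = (- x :: real)" for x
    by (simp add: m flip: mult.assoc power_add)
  have last: "(-1) ^ n * newton_e ?p n = - (pn / real n + gamma_shift n q)"
  proof -
    have "(-1) ^ n * ((-1) ^ (n - 1) * (pn - x) / real n) = - (pn / real n + - (1 / real n) * x)" for x
      using sgn [of "(pn - x) / real n"] assms by (simp add: field_simps)
    then show ?thesis
      using assms by (subst newton_e.simps) (simp only: sum nth gamma_shift_def, simp)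
  qed
  have "power_sum_poly ?p = (\<Sum>j=0..m. monom ((-1) ^ j * newton_e ?p j) (n - j)) +
      monom ((-1) ^ n * newton_e ?p n) (n - n)"
    unfolding power_sum_poly_eq_newton len by (simp add: m)
  also have "(\<Sum>j=0..m. monom ((-1) ^ j * newton_e ?p j) (n - j)) = R_poly n q"
    unfolding R_poly_def by (intro sum.cong) (auto simp: m e)
  finally show ?thesis
    by (simp only: last) (simp add: monom_0)
qed

lemma roots_disc_Cons: "roots_disc (x # us) = (\<Prod>u\<leftarrow>us. (x - u)\<^sup>2) * roots_disc us"
  by (simp add: roots_disc_def prod.lessThan_Suc_shift prod.distrib prod.list_conv_set_nth
      atLeast0LessThan del: prod.lessThan_Suc)

lemma roots_disc_insert:
  "roots_disc (us @ x # vs) = (\<Prod>u\<leftarrow>us @ vs. (x - u)\<^sup>2) * roots_disc (us @ vs)"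
  by (induction us) (simp_all add: roots_disc_Cons power2_commute mult_ac)

lemma roots_disc_cong: "mset us = mset vs \<Longrightarrow> roots_disc us = roots_disc vs"
proof (induction us arbitrary: vs)
  case (Cons x us)
  then have "x \<in> set vs" by (metis list.set_intros(1) mset_eq_setD)
  then obtain as bs where vs: "vs = as @ x # bs" by (meson split_list)
  with Cons.prems have m: "mset us = mset (as @ bs)" by simp
  then have "(\<Prod>u\<leftarrow>us. (x - u)\<^sup>2) = (\<Prod>u\<leftarrow>as @ bs. (x - u)\<^sup>2)"
    by (metis mset_map prod_mset_prod_list)
  with Cons.IH [OF m] show ?case
    by (simp add: vs roots_disc_Cons roots_disc_insert)
qed simp

lemma Disc_eqI:
  assumes "map_poly complex_of_real P = (\<Prod>u\<leftarrow>us. [:-u, 1:])"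
  shows "Disc P = Re (roots_disc us)"
proof -
  have "proots (map_poly complex_of_real P) = mset us"
    unfolding assms
  proof (induction us)
    case (Cons u us)
    have "(\<Prod>u\<leftarrow>us. [:-u, 1:]) \<noteq> 0" by (auto simp: prod_list_zero_iff)
    with Cons show ?case by (simp add: proots_mult del: mult_pCons_left)
  qed simp
  moreover have "mset (SOME us'. mset us' = mset us) = mset us"
    by (rule someI) (rule refl)
  ultimately show ?thesis
    unfolding Disc_def using roots_disc_cong by metis
qed

lemma of_real_Disc:
  assumes "map_poly complex_of_real P = (\<Prod>u\<leftarrow>us. [:-u, 1:])"
  shows "complex_of_real (Disc P) = roots_disc us"
proof -
  have cnj_prod: "map_poly cnj (\<Prod>u\<leftarrow>vs. [:-u, 1:]) = (\<Prod>u\<leftarrow>map cnj vs. [:-u, 1:])" for vs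
  proof (induction vs)
    case (Cons v vs)
    have "map_poly cnj ([:-v, 1:] * Q) = [:-cnj v, 1:] * map_poly cnj Q" for Q
      by (rule poly_eqI) (auto simp: coeff_map_poly coeff_pCons split: nat.split)
    with Cons show ?case by (simp del: mult_pCons_left)
  qed (simp add: map_poly_1')
  have pr: "proots (\<Prod>u\<leftarrow>vs. [:-u, 1:]) = mset vs" for vs :: "complex list"
  proof (induction vs)
    case (Cons v vs)
    have "(\<Prod>u\<leftarrow>vs. [:-u, 1:]) \<noteq> 0" by (auto simp: prod_list_zero_iff)
    with Cons show ?case by (simp add: proots_mult del: mult_pCons_left)
  qed simp
  have "map_poly cnj (map_poly complex_of_real P) = map_poly complex_of_real P"
    by (rule poly_eqI) (simp add: coeff_map_poly)
  then have "(\<Prod>u\<leftarrow>map cnj us. [:-u, 1:]) = (\<Prod>u\<leftarrow>us. [:-u, 1:])"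
    using cnj_prod assms by metis
  then have "mset (map cnj us) = mset us"
    using pr by metis
  then have "roots_disc (map cnj us) = roots_disc us"
    by (rule roots_disc_cong)
  moreover have "roots_disc (map cnj us) = cnj (roots_disc us)"
    by (simp add: roots_disc_def)
  ultimately have "roots_disc us \<in> \<real>"
    by (simp add: Reals_cnj_iff)
  then show ?thesis
    using Disc_eqI [OF assms] by simp
qed

end

theory Submission
  imports Defs
begin

text \<open>
  Changing the last power sum moves the graph of \<open>R\<close> vertically, and all polynomials \<open>P = R - t\<close> have
  the same critical points \<open>w j\<close>, with critical values \<open>v j - t\<close>. All three claims express properties
  of \<open>P\<close> through these values.

  A polynomial with simple real critical points has only real roots exactly when its minima lie on or
  below the axis and its maxima on or above it (lemma \<open>real_rooted_iff_signs_at_critical_points\<close>).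
  That such a polynomial must satisfy the sign conditions is Laguerre's inequality \<open>p p'' \<le> p'\<^sup>2\<close>, read
  at a critical point. Conversely the signs produce a root between neighbouring critical points, and
  where two of these roots merge they do so at a critical point, hence in a root of multiplicity two.
  So \<open>P\<close> is real-rooted iff \<open>t\<close> lies between the largest minimum \<open>L\<close> and the smallest maximum \<open>U\<close>. If
  \<open>R'\<close> is not real-rooted, then no \<open>P\<close> is, because the derivative of a real-rooted polynomial is
  real-rooted (lemma \<open>real_rooted_pderiv\<close>).

  The discriminant of \<open>P\<close> is up to sign the product of \<open>P'\<close> over the roots of \<open>P\<close>, which is the resultant
  of \<open>P\<close> and \<open>P'\<close> and therefore up to a power of \<open>n\<close> the product of the critical values
  (lemma \<open>abs_Disc_eq_prod_critical_values\<close>). As a function of the last power sum it is thus a product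
  of linear factors. On the fibre it is not negative, two of its factors vanish at the two ends of the
  interval, and the others have their zeros outside. The affine substitution onto the unit interval then
  turns the integral of its inverse square root into Euler's integral for \<open>F\<^sub>D\<close>
  (lemma \<open>integral_inverse_sqrt_prod_linear\<close>).
\<close>

section \<open>Real-rooted polynomials\<close>

text \<open>
  A real polynomial whose real roots, counted with multiplicity, number its degree is a constant
  times a product of linear factors. Peeling these off one at a time turns statements about such
  polynomials into polynomial identities for a single step \<open>q \<mapsto> (X - u) q\<close>, so that
  neither an enumeration of the roots nor a division by \<open>p\<close> is necessary.
\<close>

lemma real_rooted_induct [consumes 2, case_names const linear_factor]:
  fixes p :: "real poly"
  assumes "p \<noteq> 0" and "size (proots p) = degree p"
    and const: "\<And>c. c \<noteq> 0 \<Longrightarrow> Q [:c:]"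
    and linear_factor: "\<And>u q. q \<noteq> 0 \<Longrightarrow> Q q \<Longrightarrow> Q ([:-u, 1:] * q)"
  shows "Q p"
  using assms(1,2)
proof (induction "degree p" arbitrary: p)
  case 0
  then show ?case using const by (metis degree_eq_zeroE pCons_0_0)
next
  case (Suc d)
  then have "proots p \<noteq> {#}" by auto
  then obtain u where "u \<in># proots p" by blast
  then have "poly p u = 0" using Suc.prems(1) by simp
  then obtain q where q: "p = [:-u, 1:] * q" by (metis dvdE poly_eq_0_iff_dvd)
  then have "q \<noteq> 0" using Suc.prems(1) by auto
  have "degree p = Suc (degree q)"
    using \<open>q \<noteq> 0\<close> unfolding q by (subst degree_mult_eq) auto
  moreover have "proots p = {#u#} + proots q"
    using \<open>q \<noteq> 0\<close> unfolding q by (subst proots_mult) auto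
  ultimately show ?case
    using Suc \<open>q \<noteq> 0\<close> linear_factor [of q u] q by auto
qed

lemma real_rooted_decompose:
  fixes p :: "real poly"
  assumes "p \<noteq> 0" and "size (proots p) = degree p"
  shows "p = smult (lead_coeff p) (\<Prod>u\<in>#proots p. [:-u, 1:])"
  using assms
proof (induction p rule: real_rooted_induct)
  case (linear_factor u q)
  have "proots ([:-u, 1:] * q) = {#u#} + proots q"
    using linear_factor(1) by (subst proots_mult) auto
  moreover have "lead_coeff ([:-u, 1:] * q) = lead_coeff q"
    by (subst lead_coeff_mult) simp
  moreover have "[:-u, 1:] * q = [:-u, 1:] * smult (lead_coeff q) (\<Prod>u\<in>#proots q. [:-u, 1:])"
    using linear_factor(2) by (rule arg_cong)
  ultimately show ?case
    by (simp only: image_mset_union prod_mset_Un image_mset_single prod_mset_singleton mult_smult_right)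
qed simp

lemma pderiv_linear_mult:
  "pderiv ([:-u, 1:] * q) = q + [:-u, 1:] * pderiv q" for u :: "'a :: idom"
  by (subst pderiv_mult) (simp add: pderiv_pCons)

text \<open>
  Away from the roots this says that \<open>(p'/p)' = - (\<Sum>u. 1 / (x - u)\<^sup>2)\<close> is not positive. In the
  form without denominators the defect \<open>p'\<^sup>2 - p p''\<close> passes from \<open>q\<close> to \<open>(X - u) q\<close> as
  \<open>q\<^sup>2 + (x - u)\<^sup>2 (q'\<^sup>2 - q q'')\<close>. At a critical point it forces the value and the second
  derivative to have opposite signs, which is the necessity half of the criterion for real roots.
\<close>

lemma laguerre_inequality:
  fixes p :: "real poly"
  assumes "p \<noteq> 0" and "size (proots p) = degree p"
  shows "poly p x * poly (pderiv (pderiv p)) x \<le> (poly (pderiv p) x)\<^sup>2"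
  using assms
proof (induction p rule: real_rooted_induct)
  case (linear_factor u q)
  define a b c where "a = poly q x" and "b = poly (pderiv q) x" and "c = poly (pderiv (pderiv q)) x"
  have "(a + (x - u) * b)\<^sup>2 - (x - u) * a * (2 * b + (x - u) * c) = a\<^sup>2 + (x - u)\<^sup>2 * (b\<^sup>2 - a * c)"
    by (simp add: power2_eq_square algebra_simps)
  moreover have "\<dots> \<ge> 0"
    using linear_factor(2) by (simp add: a_def b_def c_def)
  moreover have "poly ([:-u, 1:] * q) x = (x - u) * a"
    "poly (pderiv ([:-u, 1:] * q)) x = a + (x - u) * b"
    "poly (pderiv (pderiv ([:-u, 1:] * q))) x = 2 * b + (x - u) * c"
    unfolding pderiv_linear_mult pderiv_add by (simp_all add: a_def b_def c_def algebra_simps)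
  ultimately show ?case by (simp only:)
qed (simp add: pderiv_pCons)

lemma map_poly_of_real_linear_mult:
  "map_poly complex_of_real ([:-u, 1:] * q) = [:-complex_of_real u, 1:] * map_poly complex_of_real q"
  by (rule poly_eqI) (auto simp: coeff_map_poly coeff_pCons split: nat.split)

lemma poly_map_poly_of_real:
  "poly (map_poly complex_of_real p) (of_real x) = of_real (poly p x)"
  by (induction p) (auto simp: map_poly_pCons)

lemma map_poly_of_real_pderiv:
  "map_poly complex_of_real (pderiv p) = pderiv (map_poly complex_of_real p)"
  by (rule poly_eqI) (simp add: coeff_map_poly coeff_pderiv)

text \<open>
  The real case of the Gauss--Lucas theorem. For real \<open>u\<close> the numbers \<open>1 / (z - u)\<close> all lie in
  the half-plane opposite to that of \<open>z\<close>, hence so does \<open>p'(z) / p(z)\<close>, their sum. Multiplied by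
  \<open>\<bar>p(z)\<bar>\<^sup>2\<close>, this becomes the sign of \<open>Im (p'(z) * cnj (p(z)))\<close>. The weak inequality has to be
  carried along as well, because constants satisfy only that one.
\<close>

lemma no_critical_point_off_axis:
  fixes p :: "real poly"
  assumes "p \<noteq> 0" and "size (proots p) = degree p" and "degree p > 0" and "Im z \<noteq> 0"
  shows "poly (map_poly complex_of_real (pderiv p)) z \<noteq> 0"
proof -
  let ?c = "\<lambda>p. map_poly complex_of_real p"
  have "poly (?c p) z \<noteq> 0 \<and> Im z * Im (poly (pderiv (?c p)) z * cnj (poly (?c p) z)) \<le> 0
    \<and> (degree p > 0 \<longrightarrow> Im z * Im (poly (pderiv (?c p)) z * cnj (poly (?c p) z)) < 0)"
    using assms(1,2)
  proof (induction p rule: real_rooted_induct)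
    case (const c)
    then show ?case by (simp add: map_poly_pCons)
  next
    case (linear_factor u q)
    define a b s where "a = poly (?c q) z" and "b = poly (pderiv (?c q)) z" and "s = z - of_real u"
    have a: "a \<noteq> 0" and IH: "Im z * Im (b * cnj a) \<le> 0"
      using linear_factor(2) by (auto simp: a_def b_def)
    have s: "s \<noteq> 0" "Im s = Im z" using assms(4) by (auto simp: s_def complex_eq_iff)
    have "(a + s * b) * cnj (s * a) = of_real ((norm a)\<^sup>2) * cnj s + of_real ((norm s)\<^sup>2) * (b * cnj a)"
      by (simp only: complex_norm_square complex_cnj_mult) (simp add: algebra_simps)
    then have eq: "Im z * Im ((a + s * b) * cnj (s * a)) =
        - ((norm a)\<^sup>2 * (Im z)\<^sup>2) + (norm s)\<^sup>2 * (Im z * Im (b * cnj a))"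
      by (simp add: s(2) power2_eq_square algebra_simps del: complex_cnj_mult)
    have "(norm a)\<^sup>2 * (Im z)\<^sup>2 > 0" using a assms(4) by simp
    moreover have "(norm s)\<^sup>2 * (Im z * Im (b * cnj a)) \<le> 0"
      using IH by (simp add: mult_nonneg_nonpos)
    ultimately have "Im z * Im ((a + s * b) * cnj (s * a)) < 0" unfolding eq by linarith
    moreover have "poly (?c ([:-u, 1:] * q)) z = s * a"
      "poly (pderiv (?c ([:-u, 1:] * q))) z = a + s * b"
      unfolding map_poly_of_real_linear_mult pderiv_linear_mult
      by (simp_all add: a_def b_def s_def algebra_simps)
    ultimately show ?case using a s by (simp del: mult_pCons_left)
  qed
  then show ?thesis
    using assms(3) by (auto simp: map_poly_of_real_pderiv)
qed

lemma real_rooted_if_complex_roots_real: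
  fixes p :: "real poly"
  assumes "p \<noteq> 0" and "\<And>z. poly (map_poly complex_of_real p) z = 0 \<Longrightarrow> Im z = 0"
  shows "size (proots p) = degree p"
  using assms
proof (induction "degree p" arbitrary: p)
  case 0
  then show ?case using size_proots_le [of p] by simp
next
  case (Suc d)
  have "degree (map_poly complex_of_real p) = degree p" by (simp add: degree_map_poly)
  then have "\<not> constant (poly (map_poly complex_of_real p))"
    using Suc.hyps(2) by (simp add: constant_degree)
  then obtain z where z: "poly (map_poly complex_of_real p) z = 0"
    using fundamental_theorem_of_algebra by blast
  then have "z = of_real (Re z)" using Suc.prems(2) by (simp add: complex_eq_iff)
  then have "complex_of_real (poly p (Re z)) = 0"
    using z by (metis poly_map_poly_of_real)
  then obtain q where q: "p = [:-Re z, 1:] * q" by (metis dvdE poly_eq_0_iff_dvd of_real_eq_0_iff)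
  then have "q \<noteq> 0" using Suc.prems(1) by auto
  have "degree p = Suc (degree q)"
    using \<open>q \<noteq> 0\<close> unfolding q by (subst degree_mult_eq) auto
  moreover have "proots p = {#Re z#} + proots q"
    using \<open>q \<noteq> 0\<close> unfolding q by (subst proots_mult) auto
  moreover have "size (proots q) = degree q"
  proof (rule Suc.hyps(1))
    fix y assume "poly (map_poly complex_of_real q) y = 0"
    then have "poly (map_poly complex_of_real p) y = 0"
      unfolding q map_poly_of_real_linear_mult by simp
    then show "Im y = 0" by (rule Suc.prems(2))
  qed (use Suc.hyps(2) calculation \<open>q \<noteq> 0\<close> in auto)
  ultimately show ?case by simp
qed

text \<open>
  All complex critical points are real, so the derivative splits over the reals. This covers
  multiplicities too, which Rolle's theorem between consecutive distinct roots leaves to a separate count.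
\<close>

lemma real_rooted_pderiv:
  fixes p :: "real poly"
  assumes "p \<noteq> 0" and "size (proots p) = degree p"
  shows "size (proots (pderiv p)) = degree (pderiv p)"
proof (cases "degree p = 0")
  case True
  then show ?thesis by (auto elim!: degree_eq_zeroE simp: pderiv_pCons)
next
  case False
  show ?thesis
    using no_critical_point_off_axis [OF assms] False
    by (intro real_rooted_if_complex_roots_real) (auto simp: pderiv_eq_0_iff)
qed

section \<open>Nondegenerate critical points\<close>

lemma taylor_at_critical_point:
  fixes p :: "real poly"
  assumes "poly (pderiv p) x = 0"
  obtains s where "\<And>y. poly p y = poly p x + (y - x)\<^sup>2 * poly s y"
    and "poly (pderiv (pderiv p)) x = 2 * poly s x"
proof -
  have "poly (p - [:poly p x:]) x = 0" by simp
  then obtain q where q: "p - [:poly p x:] = [:-x, 1:] * q" by (metis dvdE poly_eq_0_iff_dvd)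
  then have p: "p = [:-x, 1:] * q + [:poly p x:]" by (metis diff_add_cancel)
  have "poly (pderiv p) x = poly q x"
    by (subst p) (simp add: pderiv_mult pderiv_add pderiv_pCons del: mult_pCons_left)
  then obtain s where s: "q = [:-x, 1:] * s" using assms by (metis dvdE poly_eq_0_iff_dvd)
  show thesis
  proof
    show "poly p y = poly p x + (y - x)\<^sup>2 * poly s y" for y
      by (subst p) (simp add: s power2_eq_square algebra_simps)
    show "poly (pderiv (pderiv p)) x = 2 * poly s x"
      by (subst p) (simp add: s pderiv_mult pderiv_add pderiv_pCons del: mult_pCons_left)
  qed
qed

lemma second_derivative_test:
  fixes p :: "real poly"
  assumes "poly (pderiv p) x = 0" and "poly (pderiv (pderiv p)) x > 0"
  shows "local_min_at (poly p) x" and "\<not> local_max_at (poly p) x"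
proof -
  obtain s where p: "\<And>y. poly p y = poly p x + (y - x)\<^sup>2 * poly s y"
    and "poly (pderiv (pderiv p)) x = 2 * poly s x"
    using taylor_at_critical_point assms(1) by blast
  then have "poly s x > 0" using assms(2) by simp
  moreover have "(poly s \<longlongrightarrow> poly s x) (nhds x)"
    using poly_isCont [of x s] by (simp add: continuous_within tendsto_nhds_iff)
  ultimately have ev: "\<forall>\<^sub>F y in nhds x. poly s y > 0"
    by (rule order_tendstoD(1) [rotated])
  show "local_min_at (poly p) x"
    unfolding local_min_at_def using ev
  proof eventually_elim
    case (elim y)
    then show ?case by (subst (2) p) simp
  qed
  show "\<not> local_max_at (poly p) x"
  proof
    assume "local_max_at (poly p) x"
    then have "\<forall>\<^sub>F y in nhds x. poly s y > 0 \<and> poly p y \<le> poly p x"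
      unfolding local_max_at_def using ev by eventually_elim simp
    then have "\<forall>\<^sub>F y in at x. poly s y > 0 \<and> poly p y \<le> poly p x"
      by (auto simp: eventually_at_filter elim: eventually_mono)
    moreover have "\<forall>\<^sub>F y in at x. y \<noteq> x" by (simp add: eventually_at_filter)
    ultimately have "\<forall>\<^sub>F y in at x. False"
    proof eventually_elim
      case (elim y)
      then have "(y - x)\<^sup>2 * poly s y > 0" by simp
      with elim p [of y] show ?case by linarith
    qed
    then show False by simp
  qed
qed

lemma local_extremum_iff:
  fixes p :: "real poly"
  assumes "poly (pderiv p) x = 0" and "poly (pderiv (pderiv p)) x \<noteq> 0"
  shows "local_min_at (poly p) x \<longleftrightarrow> poly (pderiv (pderiv p)) x > 0"
    and "local_max_at (poly p) x \<longleftrightarrow> poly (pderiv (pderiv p)) x < 0"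
proof -
  have "local_min_at (poly (- p)) x = local_max_at (poly p) x"
    "local_max_at (poly (- p)) x = local_min_at (poly p) x"
    by (simp_all add: local_min_at_def local_max_at_def)
  then show "local_min_at (poly p) x \<longleftrightarrow> poly (pderiv (pderiv p)) x > 0"
    and "local_max_at (poly p) x \<longleftrightarrow> poly (pderiv (pderiv p)) x < 0"
    using second_derivative_test [of p x] second_derivative_test [of "- p" x] assms
    by (cases "poly (pderiv (pderiv p)) x > 0"; simp add: pderiv_minus)+
qed

text \<open>
  At the \<open>i\<close>-th of \<open>m\<close> simple roots the derivative is \<open>c\<close> times the product of the differences
  \<open>w i - w j\<close>, of which exactly the \<open>m - i\<close> with \<open>j > i\<close> are negative. If the product
  is the derivative of \<open>p\<close>, its ordered zeros are alternately maxima and minima of \<open>p\<close>, the last one a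
  minimum.
\<close>

lemma pderiv_at_simple_root_sign:
  fixes w :: "nat \<Rightarrow> real"
  assumes "strict_mono_on {1..m} w" and "i \<in> {1..m}" and "c > 0"
  shows "(-1) ^ (m - i) * poly (pderiv (smult c (\<Prod>j=1..m. [:-w j, 1:]))) (w i) > 0"
proof -
  have less: "w j < w k" if "j < k" "j \<in> {1..m}" "k \<in> {1..m}" for j k
    using assms(1) that by (auto simp: strict_mono_on_def)
  have split: "{1..m} - {i} = {1..<i} \<union> {i<..m}" using assms(2) by auto
  have "poly (pderiv (\<Prod>j=1..m. [:-w j, 1:])) (w i) = (\<Prod>j\<in>{1..m} - {i}. w i - w j)"
    using assms(2)
    by (subst prod.remove [of _ i]) (auto simp: pderiv_mult pderiv_pCons poly_prod simp del: mult_pCons_left)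
  also have "\<dots> = (\<Prod>j\<in>{1..<i}. w i - w j) * (\<Prod>j\<in>{i<..m}. w i - w j)"
    unfolding split by (rule prod.union_disjoint) auto
  also have "(\<Prod>j\<in>{i<..m}. w i - w j) = (-1) ^ (m - i) * (\<Prod>j\<in>{i<..m}. w j - w i)"
  proof -
    have "(\<Prod>j\<in>{i<..m}. w i - w j) = (\<Prod>j\<in>{i<..m}. (-1) * (w j - w i))" by simp
    also have "\<dots> = (-1) ^ (m - i) * (\<Prod>j\<in>{i<..m}. w j - w i)" by (subst prod.distrib) simp
    finally show ?thesis .
  qed
  finally have eq: "(-1) ^ (m - i) * poly (pderiv (smult c (\<Prod>j=1..m. [:-w j, 1:]))) (w i) =
      c * ((\<Prod>j\<in>{1..<i}. w i - w j) * (\<Prod>j\<in>{i<..m}. w j - w i))"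
    by (simp add: pderiv_smult algebra_simps flip: power_add mult_2)
  have "(\<Prod>j\<in>{1..<i}. w i - w j) > 0" "(\<Prod>j\<in>{i<..m}. w j - w i) > 0"
    using less assms(2) by (auto intro!: prod_pos)
  then show ?thesis unfolding eq using assms(3) by simp
qed

lemma eq_prod_linear_factors:
  fixes p :: "real poly"
  assumes "p \<noteq> 0" "inj_on w J" "finite J" "card J = degree p" "\<And>j. j \<in> J \<Longrightarrow> poly p (w j) = 0"
  shows "p = smult (lead_coeff p) (\<Prod>j\<in>J. [:-w j, 1:])"
proof -
  have "image_mset w (mset_set J) \<subseteq># proots p"
  proof (rule mset_subset_eqI)
    fix x
    have "count (mset_set (w ` J)) x \<le> order x p"
      using assms by (auto simp: count_mset_set' Suc_le_eq order_gt_0_iff)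
    then show "count (image_mset w (mset_set J)) x \<le> count (proots p) x"
      using assms by (simp add: image_mset_mset_set)
  qed
  moreover have "size (proots p) \<le> size (image_mset w (mset_set J))"
    using size_proots_le [of p] assms by simp
  ultimately have eq: "proots p = image_mset w (mset_set J)"
    by (metis mset_subset_size subset_mset.nless_le not_le)
  have "size (proots p) = degree p" unfolding eq using assms by simp
  from real_rooted_decompose [OF assms(1) this] show ?thesis
    by (simp add: eq multiset.map_comp o_def prod_unfold_prod_mset)
qed

section \<open>Real-rootedness and the signs of the critical values\<close>

text \<open>
  Each interval \<open>[x (i - 1), x i]\<close> contains a root \<open>u i\<close> by the intermediate value theorem. The
  \<open>n\<close> roots so found need not be distinct, as the signs are only weak: two of them coincide when they
  are the common endpoint of neighbouring intervals. Such an endpoint is a critical point and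
  therefore a root of multiplicity at least two, so the family \<open>u\<close> is still a submultiset of the roots.
\<close>

lemma real_rooted_if_signs_alternate:
  fixes p :: "real poly" and x :: "nat \<Rightarrow> real"
  assumes "p \<noteq> 0" and "degree p = n" and mono: "strict_mono_on {0..n} x"
    and sign: "\<And>i. i \<le> n \<Longrightarrow> (-1) ^ (n - i) * poly p (x i) \<ge> 0"
    and crit: "\<And>i. i \<in> {1..<n} \<Longrightarrow> poly (pderiv p) (x i) = 0"
  shows "size (proots p) = n"
proof -
  have less: "x i < x k" if "i < k" "k \<le> n" for i k
    using mono that by (auto simp: strict_mono_on_def)
  have "\<exists>u. x (i - 1) \<le> u \<and> u \<le> x i \<and> poly p u = 0" if i: "i \<in> {1..n}" for i
  proof -
    let ?f = "\<lambda>y. (-1) ^ (n - i) * poly p y"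
    obtain k where k: "i = Suc k" using i by (cases i) auto
    have "n - k = Suc (n - i)" using i k by auto
    then have "?f (x k) \<le> 0" using sign [of k] i k by simp
    moreover have "0 \<le> ?f (x i)" using sign [of i] i by simp
    moreover have "x k \<le> x i" using less [of k i] i k by simp
    moreover have "continuous_on {x k..x i} ?f" by (intro continuous_intros)
    ultimately have "\<exists>u. x k \<le> u \<and> u \<le> x i \<and> ?f u = 0" by (rule IVT')
    then show ?thesis using k by auto
  qed
  then obtain u where u: "\<And>i. i \<in> {1..n} \<Longrightarrow> x (i - 1) \<le> u i \<and> u i \<le> x i \<and> poly p (u i) = 0"
    by metis
  have "image_mset u (mset_set {1..n}) \<subseteq># proots p"
  proof (rule mset_subset_eqI)
    fix a
    let ?A = "{i \<in> {1..n}. u i = a}"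
    have "card ?A \<le> order a p"
    proof (cases "?A = {}")
      case False
      define i where "i = Min ?A"
      have i: "i \<in> ?A" unfolding i_def using False by (intro Min_in) auto
      then have "poly p a = 0" using u [of i] by auto
      then have order: "order a p = Suc (order a (pderiv p))"
        using assms(1) order_pderiv by blast
      \<comment> \<open>Two intervals that share a root are adjacent, and the root is their common endpoint.\<close>
      have later: "k = Suc i \<and> a = x i" if "k \<in> ?A" "k \<noteq> i" for k
      proof -
        have "i \<le> k" unfolding i_def using that by (intro Min_le) auto
        then have "i < k" using that by simp
        have "a \<le> x i" "x (k - 1) \<le> a" using u [of i] u [of k] i that by auto
        moreover have "k - 1 \<le> n" using that by auto
        ultimately have "\<not> i < k - 1" using less [of i "k - 1"] by fastforce
        then have "k = Suc i" using \<open>i < k\<close> by simp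
        then show ?thesis using \<open>a \<le> x i\<close> \<open>x (k - 1) \<le> a\<close> by simp
      qed
      show ?thesis
      proof (cases "\<exists>k\<in>?A. k \<noteq> i")
        case True
        then have "a = x i" "Suc i \<in> ?A" using later by blast+
        then have "poly (pderiv p) a = 0" using crit [of i] i by auto
        moreover have "pderiv p \<noteq> 0"
          using \<open>Suc i \<in> ?A\<close> assms(2) by (auto simp: pderiv_eq_0_iff)
        ultimately have "order a p \<ge> 2" using order by (simp add: order_root Suc_le_eq)
        moreover have "card ?A \<le> card {i, Suc i}" using later by (intro card_mono) auto
        ultimately show ?thesis by simp
      next
        case False
        then have "card ?A \<le> card {i}" by (intro card_mono) auto
        then show ?thesis using order by simp
      qed
    next
      case True
      show ?thesis unfolding True by simp
    qed
    moreover have "count (image_mset u (mset_set {1..n})) a = (\<Sum>i\<in>?A. 1)"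
      unfolding count_image_mset' by (intro sum.cong) auto
    ultimately show "count (image_mset u (mset_set {1..n})) a \<le> count (proots p) a"
      using assms(1) by simp
  qed
  from size_mset_mono [OF this] show ?thesis
    using size_proots_le [of p] assms(2) by simp
qed

lemma sign_at_infinity:
  fixes p :: "real poly"
  assumes "lead_coeff p > 0"
  obtains a b where "\<And>x. x \<le> a \<Longrightarrow> (-1) ^ degree p * poly p x > 0" and "\<And>x. x \<ge> b \<Longrightarrow> poly p x > 0"
proof -
  \<comment> \<open>The reflection \<open>x \<mapsto> - x\<close>, with the sign that keeps the leading coefficient positive.\<close>
  define q where "q = smult ((-1) ^ degree p) (pcompose p [:0, -1:])"
  have "lead_coeff (pcompose p [:0, -1:]) = lead_coeff p * (-1) ^ degree p"
    by (subst lead_coeff_comp) auto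
  then have "lead_coeff q = lead_coeff p"
    unfolding q_def lead_coeff_smult by (simp add: power_add [symmetric] mult.left_commute flip: mult_2)
  then obtain a where a: "\<And>x. x \<ge> a \<Longrightarrow> poly q x \<ge> lead_coeff q"
    using poly_pinfty_gt_lc [of q] assms by auto
  obtain b where b: "\<And>x. x \<ge> b \<Longrightarrow> poly p x \<ge> lead_coeff p"
    using poly_pinfty_gt_lc [of p] assms by auto
  show thesis
  proof
    show "(-1) ^ degree p * poly p x > 0" if "x \<le> - a" for x
    proof -
      have "lead_coeff p \<le> poly q (- x)" using a [of "- x"] that \<open>lead_coeff q = lead_coeff p\<close> by simp
      then show ?thesis using assms by (simp add: q_def poly_pcompose)
    qed
    show "poly p x > 0" if "x \<ge> b" for x
      using b [OF that] assms by simp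
  qed
qed

text \<open>
  The last critical point is a minimum and has to lie below the axis, the one before is a maximum and
  has to lie above it, and so on. Necessity is Laguerre's inequality; for sufficiency one point near each
  infinity is added to the critical points, which makes \<open>m + 2\<close> points of alternating sign.
\<close>

lemma real_rooted_iff_signs_at_critical_points:
  fixes p :: "real poly" and w :: "nat \<Rightarrow> real"
  assumes "lead_coeff p > 0" and "degree p = Suc m" and "m \<ge> 1" and mono: "strict_mono_on {1..m} w"
    and p': "pderiv p = smult c (\<Prod>j=1..m. [:-w j, 1:])" and "c > 0"
  shows "size (proots p) = degree p \<longleftrightarrow> (\<forall>i\<in>{1..m}. (-1) ^ (m - i) * poly p (w i) \<le> 0)"
proof
  assume real_rooted: "size (proots p) = degree p"
  show "\<forall>i\<in>{1..m}. (-1) ^ (m - i) * poly p (w i) \<le> 0"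
  proof
    fix i assume i: "i \<in> {1..m}"
    define s a b where "s = (-1 :: real) ^ (m - i)" and "a = poly p (w i)" and "b = poly (pderiv (pderiv p)) (w i)"
    have "poly (pderiv p) (w i) = 0" unfolding p' using i by (auto simp: poly_prod)
    then have "a * b \<le> 0"
      unfolding a_def b_def using laguerre_inequality [of p "w i"] real_rooted assms(1) by force
    moreover have "s * s = 1" by (simp add: s_def flip: power_add mult_2)
    then have "(s * a) * (s * b) = a * b" by (metis mult.left_commute mult.assoc mult_1)
    moreover have "s * b > 0"
      unfolding s_def b_def p' using pderiv_at_simple_root_sign [OF mono i \<open>c > 0\<close>] .
    ultimately show "(-1) ^ (m - i) * poly p (w i) \<le> 0"
      unfolding s_def [symmetric] a_def [symmetric] by (metis mult_le_0_iff not_le)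
  qed
next
  assume signs: "\<forall>i\<in>{1..m}. (-1) ^ (m - i) * poly p (w i) \<le> 0"
  obtain a b where a: "\<And>x. x \<le> a \<Longrightarrow> (-1) ^ degree p * poly p x > 0" and b: "\<And>x. x \<ge> b \<Longrightarrow> poly p x > 0"
    using sign_at_infinity assms(1) by blast
  \<comment> \<open>The two points added at the ends have to lie beyond all critical points.\<close>
  define x where "x i = (if i = 0 then min a (w 1 - 1) else if i = Suc m then max b (w m + 1) else w i)" for i
  have le: "w i \<le> w k" if "i \<le> k" "i \<ge> 1" "k \<le> m" for i k
    using mono that by (cases "i = k") (auto simp: strict_mono_on_def intro!: less_imp_le)
  have x: "x 0 = min a (w 1 - 1)" "x (Suc m) = max b (w m + 1)" "\<And>i. i \<in> {1..m} \<Longrightarrow> x i = w i"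
    by (auto simp: x_def)
  show "size (proots p) = degree p"
  proof (rule real_rooted_if_signs_alternate)
    show "strict_mono_on {0..degree p} x"
    proof (rule strict_mono_onI)
      fix i k assume ik: "i \<in> {0..degree p}" "k \<in> {0..degree p}" "i < k"
      have 1: "x 0 < w j" if "j \<in> {1..m}" for j using le [of 1 j] that x(1) by auto
      have 2: "w j < x (Suc m)" if "j \<in> {1..m}" for j using le [of j m] that x(2) by auto
      have "x 0 < x (Suc m)" using 1 [of 1] 2 [of 1] assms(3) by auto
      moreover have "w i < w k" if "i \<in> {1..m}" "k \<in> {1..m}" using mono that ik by (auto simp: strict_mono_on_def)
      moreover have "i = 0 \<or> i \<in> {1..m}" "k = Suc m \<or> k \<in> {1..m}" using ik assms(2) by auto
      ultimately show "x i < x k" using 1 2 x(3) by metis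
    qed
    show "(-1) ^ (degree p - i) * poly p (x i) \<ge> 0" if "i \<le> degree p" for i
    proof -
      consider "i = 0" | "i = Suc m" | "i \<in> {1..m}" using \<open>i \<le> degree p\<close> assms(2) by fastforce
      then show ?thesis
      proof cases
        case 1
        then show ?thesis using a [of "x 0"] x(1) by simp
      next
        case 2
        then show ?thesis using b [of "x (Suc m)"] x(2) assms(2) by simp
      next
        case 3
        then have "degree p - i = Suc (m - i)" using assms(2) by auto
        then show ?thesis using signs 3 x(3) by simp
      qed
    qed
    show "poly (pderiv p) (x i) = 0" if "i \<in> {1..<degree p}" for i
      unfolding p' using that x(3) assms(2) by (auto simp: poly_prod)
  qed (use assms in auto)
qed

section \<open>The discriminant\<close>

lemma poly_prod_list_linear:
  "poly (\<Prod>u\<leftarrow>us. [:-u, 1:]) x = (\<Prod>u\<leftarrow>us. x - u)" for x :: "'a :: comm_ring_1"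
  by (induction us) (simp_all add: left_diff_distrib)

text \<open>
  At a root the derivative is the product of the differences to all the other roots, so the right-hand
  side contains every pair of roots twice, which amounts to the square in the discriminant.
\<close>

lemma norm_roots_disc:
  "norm (roots_disc us) = (\<Prod>u\<leftarrow>us. norm (poly (pderiv (\<Prod>v\<leftarrow>us. [:-v, 1:])) u))"
proof (induction us)
  case Nil
  show ?case by (simp add: roots_disc_def)
next
  case (Cons x us)
  let ?p = "\<Prod>v\<leftarrow>us. [:-v, 1:]"
  have p': "poly (pderiv (\<Prod>v\<leftarrow>x # us. [:-v, 1:])) u = poly ?p u + (u - x) * poly (pderiv ?p) u" for u
    by (simp add: pderiv_linear_mult algebra_simps del: mult_pCons_left)
  have at: "map (\<lambda>u. norm (poly (pderiv (\<Prod>v\<leftarrow>x # us. [:-v, 1:])) u)) us =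
      map (\<lambda>u. norm (x - u) * norm (poly (pderiv ?p) u)) us"
  proof (rule map_cong)
    fix u assume "u \<in> set us"
    then have "poly ?p u = 0" unfolding poly_prod_list_linear by (auto simp: prod_list_zero_iff)
    then show "norm (poly (pderiv (\<Prod>v\<leftarrow>x # us. [:-v, 1:])) u) = norm (x - u) * norm (poly (pderiv ?p) u)"
      unfolding p' by (simp add: norm_mult norm_minus_commute)
  qed simp
  have distrib: "(\<Prod>u\<leftarrow>us. f u * g u) = (\<Prod>u\<leftarrow>us. f u) * (\<Prod>u\<leftarrow>us. g u)" for f g :: "complex \<Rightarrow> real"
    by (induction us) (auto simp: algebra_simps)
  have norm: "norm (\<Prod>u\<leftarrow>us. f u) = (\<Prod>u\<leftarrow>us. norm (f u))" for f :: "complex \<Rightarrow> complex"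
    by (induction us) (auto simp: norm_mult)
  have "(\<Prod>u\<leftarrow>x # us. norm (poly (pderiv (\<Prod>v\<leftarrow>x # us. [:-v, 1:])) u)) =
      norm (poly ?p x) * ((\<Prod>u\<leftarrow>us. norm (x - u)) * norm (roots_disc us))"
    unfolding list.map(2) [of "\<lambda>u. norm (poly (pderiv (\<Prod>v\<leftarrow>x # us. [:-v, 1:])) u)" x us]
      prod_list.Cons [of "norm _"] Cons.IH at distrib p' [of x]
    by simp
  also have "\<dots> = norm (roots_disc (x # us))"
    by (simp add: roots_disc_Cons norm_mult norm norm_power poly_prod_list_linear power2_eq_square distrib)
  finally show ?case ..
qed

text \<open>
  The resultant of \<open>p\<close> and \<open>p'\<close> read in two ways. Up to sign and powers of \<open>c\<close> it is the product
  of \<open>u - w j\<close> over all complex roots \<open>u\<close> of \<open>p\<close> and all \<open>j\<close>. The factors with a fixed \<open>u\<close> give the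
  value of \<open>p'\<close> at that root, those with a fixed \<open>j\<close> the value of \<open>p\<close> at that critical point.
\<close>

lemma abs_Disc_eq_prod_critical_values:
  fixes p :: "real poly"
  assumes "lead_coeff p = 1" and p': "pderiv p = smult c (\<Prod>j\<in>J. [:-w j, 1:])"
  shows "\<bar>Disc p\<bar> = \<bar>c\<bar> ^ degree p * (\<Prod>j\<in>J. \<bar>poly p (w j)\<bar>)"
proof -
  let ?p = "map_poly complex_of_real p"
  have deg: "degree ?p = degree p" by (simp add: degree_map_poly)
  then have "lead_coeff ?p = 1" using assms(1) by (simp add: coeff_map_poly)
  then have "?p = (\<Prod>x\<in>#proots ?p. [:-x, 1:])"
    using complex_poly_decompose_multiset [of ?p] by simp
  also obtain us where us: "mset us = proots ?p" using ex_mset by blast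
  have "(\<Prod>x\<in>#proots ?p. [:-x, 1:]) = (\<Prod>u\<leftarrow>us. [:-u, 1:])"
    by (simp flip: us prod_mset_prod_list)
  finally have p: "?p = (\<Prod>u\<leftarrow>us. [:-u, 1:])" .
  have len: "length us = degree p"
    using us size_proots_complex [of ?p] deg by (metis size_mset)
  have prod: "map_poly complex_of_real (\<Prod>j\<in>J. [:-w j, 1:]) = (\<Prod>j\<in>J. [:- complex_of_real (w j), 1:])"
    by (induction J rule: infinite_finite_induct) (simp_all add: map_poly_of_real_linear_mult del: mult_pCons_left)
  have "pderiv ?p = smult (of_real c) (\<Prod>j\<in>J. [:- complex_of_real (w j), 1:])"
    by (simp add: map_poly_smult p' flip: map_poly_of_real_pderiv prod)
  then have p'_at: "norm (poly (pderiv ?p) u) = \<bar>c\<bar> * (\<Prod>j\<in>J. norm (complex_of_real (w j) - u))" for u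
    by (simp add: poly_prod norm_mult norm_minus_commute flip: prod_norm)
  \<comment> \<open>The interchange of the two products, for an arbitrary list of roots to allow induction.\<close>
  have swap: "(\<Prod>u\<leftarrow>vs. \<bar>c\<bar> * (\<Prod>j\<in>J. norm (complex_of_real (w j) - u))) =
      \<bar>c\<bar> ^ length vs * (\<Prod>j\<in>J. norm (\<Prod>u\<leftarrow>vs. complex_of_real (w j) - u))" for vs
    by (induction vs) (auto simp: prod.distrib norm_mult)
  have "\<bar>Disc p\<bar> = norm (roots_disc us)"
    using of_real_Disc [OF p] by (metis norm_of_real)
  also have "\<dots> = (\<Prod>u\<leftarrow>us. \<bar>c\<bar> * (\<Prod>j\<in>J. norm (complex_of_real (w j) - u)))"
    unfolding norm_roots_disc p [symmetric] p'_at ..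
  also have "\<dots> = \<bar>c\<bar> ^ degree p * (\<Prod>j\<in>J. norm (poly ?p (complex_of_real (w j))))"
    unfolding swap len p poly_prod_list_linear ..
  finally show ?thesis unfolding poly_map_poly_of_real norm_of_real .
qed

lemma Disc_nonneg_if_real_rooted:
  fixes p :: "real poly"
  assumes "lead_coeff p = 1" and "size (proots p) = degree p"
  shows "Disc p \<ge> 0"
proof -
  obtain us where us: "mset us = proots p" using ex_mset by blast
  have "p = (\<Prod>u\<in>#proots p. [:-u, 1:])"
    using real_rooted_decompose [OF _ assms(2)] assms(1) by force
  also have "\<dots> = (\<Prod>u\<leftarrow>us. [:-u, 1:])"
    by (simp flip: us prod_mset_prod_list)
  finally have "p = (\<Prod>u\<leftarrow>us. [:-u, 1:])" .
  moreover have "map_poly complex_of_real (\<Prod>u\<leftarrow>vs. [:-u, 1:]) = (\<Prod>u\<leftarrow>map of_real vs. [:-u, 1:])" for vs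
    by (induction vs) (simp_all add: map_poly_of_real_linear_mult del: mult_pCons_left)
  ultimately have "Disc p = Re (roots_disc (map of_real us))"
    by (intro Disc_eqI) simp
  also have "roots_disc (map of_real us) =
      complex_of_real (\<Prod>j<length us. \<Prod>i<j. (us ! i - us ! j)\<^sup>2)"
    unfolding roots_disc_def of_real_prod length_map by (intro prod.cong) auto
  finally show ?thesis by (simp only: Re_complex_of_real) (simp add: prod_nonneg)
qed

section \<open>The integral of the inverse square root\<close>

text \<open>
  The factors \<open>1 - y j * x\<close> stay away from zero on the compact interval, so a product of powers of them is
  bounded there and the Beta density is an integrable majorant up to a constant.
\<close>

lemma lauricella_integrable:
  fixes y :: "'i \<Rightarrow> real"
  assumes "finite J" and "\<And>j. j \<in> J \<Longrightarrow> y j < 1" and "a > 0" and "c > a"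
  shows "set_integrable lborel {0..1}
    (\<lambda>x. x powr (a - 1) * (1 - x) powr (c - a - 1) * (\<Prod>j\<in>J. (1 - y j * x) powr (- b j)))"
proof -
  let ?h = "\<lambda>x. \<Prod>j\<in>J. (1 - y j * x) powr (- b j)"
  have pos: "1 - y j * x > 0" if "j \<in> J" "x \<in> {0..1}" for j x
  proof (cases "y j \<le> 0")
    case True
    then have "y j * x \<le> 0" using that by (simp add: mult_nonpos_nonneg)
    then show ?thesis by simp
  next
    case False
    then have "y j * x \<le> y j * 1" using that by (intro mult_left_mono) auto
    then show ?thesis using assms(2) [OF that(1)] by simp
  qed
  then have "\<forall>x\<in>{0..1}. 1 - y j * x \<noteq> 0" if "j \<in> J" for j
    using that by fastforce
  then have "continuous_on {0..1} ?h"
    by (intro continuous_intros) auto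
  then have "compact (?h ` {0..1})"
    by (rule compact_continuous_image) simp
  then obtain B where B: "\<And>x. x \<in> {0..1} \<Longrightarrow> norm (?h x) \<le> B"
    by (meson bounded_iff compact_imp_bounded imageI)
  have "set_integrable lborel {0..1} (\<lambda>x. B * (x powr (a - 1) * (1 - x) powr (c - a - 1)))"
    using integrable_Beta [of a "c - a"] assms(3,4) by (intro set_integrable_mult_right) auto
  then show ?thesis
  proof (rule set_integrable_bound)
    show "AE x in lborel. x \<in> {0..1} \<longrightarrow>
        norm (x powr (a - 1) * (1 - x) powr (c - a - 1) * ?h x) \<le> norm (B * (x powr (a - 1) * (1 - x) powr (c - a - 1)))"
    proof (intro AE_I2 impI)
      fix x :: real assume "x \<in> {0..1}"
      have "norm (x powr (a - 1) * (1 - x) powr (c - a - 1)) * norm (?h x)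
          \<le> norm (x powr (a - 1) * (1 - x) powr (c - a - 1)) * \<bar>B\<bar>"
        using B [OF \<open>x \<in> {0..1}\<close>] by (intro mult_left_mono) auto
      then show "norm (x powr (a - 1) * (1 - x) powr (c - a - 1) * ?h x) \<le> norm (B * (x powr (a - 1) * (1 - x) powr (c - a - 1)))"
        unfolding norm_mult real_norm_def [of B] by (simp only: mult_ac)
    qed
  qed (simp add: set_borel_measurable_def)
qed

text \<open>
  The affine substitution \<open>p = a + (b - a) x\<close> turns \<open>p - \<rho> j\<close> into \<open>(a - \<rho> j) (1 - y j * x)\<close>. The
  factors \<open>b - a\<close> from the two endpoints cancel the Jacobian, and what is left is Euler's integral,
  whose normalising constant is \<open>\<Gamma>(1) / \<Gamma>(1/2)\<^sup>2 = 1 / \<pi>\<close>. At the endpoints both sides of the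
  substitution vanish, since \<open>1 / 0 = 0\<close> and \<open>0 powr s = 0\<close>.
\<close>

lemma integral_inverse_sqrt_prod_linear:
  fixes a b c :: real and \<rho> :: "'i \<Rightarrow> real"
  assumes "a < b" and "c > 0" and "finite J" and out: "\<And>j. j \<in> J \<Longrightarrow> \<rho> j < a \<or> b < \<rho> j"
  defines "y \<equiv> \<lambda>j. (b - a) / (\<rho> j - a)"
    and "f \<equiv> \<lambda>p. 1 / sqrt (c * (\<bar>p - a\<bar> * \<bar>p - b\<bar> * (\<Prod>j\<in>J. \<bar>p - \<rho> j\<bar>)))"
  shows "\<And>j. j \<in> J \<Longrightarrow> y j < 1"
    and "set_integrable lborel {a..b} f"
    and "(LBINT p:{a..b}. f p) =
      pi * lauricella_FD (1/2) J (\<lambda>_. 1/2) 1 y / (sqrt c * (\<Prod>j\<in>J. sqrt \<bar>a - \<rho> j\<bar>))"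
proof -
  define d where "d = b - a"
  define C where "C = sqrt c * (\<Prod>j\<in>J. sqrt \<bar>a - \<rho> j\<bar>)"
  define g where "g x = x powr (1/2 - 1) * (1 - x) powr (1 - 1/2 - 1) * (\<Prod>j\<in>J. (1 - y j * x) powr (- (1/2)))" for x
  have d: "d > 0" using assms(1) by (simp add: d_def)
  show y: "y j < 1" if "j \<in> J" for j
    using out [OF that] assms(1) by (auto simp: y_def divide_simps)
  have half: "t powr (- (1/2)) = 1 / sqrt t" if "t \<ge> 0" for t :: real
    using that by (simp add: powr_minus powr_half_sqrt inverse_eq_divide)
  have sqrt_prod: "sqrt (\<Prod>j\<in>J. h j) = (\<Prod>j\<in>J. sqrt (h j))" for h
    by (induction J rule: infinite_finite_induct) (auto simp: real_sqrt_mult)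
  have pullback: "indicator {a..b} (a + d * x) *\<^sub>R f (a + d * x) = (1 / (d * C)) * (indicator {0..1} x *\<^sub>R g x)" for x
  proof (cases "x \<in> {0..1}")
    case False
    have "a + d * x \<in> {a..b} \<longleftrightarrow> 0 \<le> d * x \<and> d * x \<le> d * 1" by (auto simp: d_def)
    then have "a + d * x \<notin> {a..b}" using d False by (simp add: zero_le_mult_iff)
    then show ?thesis using False by simp
  next
    case True
    then have "d * x \<ge> 0" "d * x \<le> d * 1" using d by (auto intro!: mult_left_mono)
    then have mem: "a + d * x \<in> {a..b}" by (auto simp: d_def)
    have lin: "sqrt \<bar>a + d * x - \<rho> j\<bar> = sqrt \<bar>a - \<rho> j\<bar> * sqrt (1 - y j * x) \<and> 1 - y j * x > 0" if "j \<in> J" for j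
    proof -
      have eq: "a + d * x - \<rho> j = (a - \<rho> j) * (1 - y j * x)"
        using out [OF that] assms(1) by (auto simp: y_def d_def field_simps)
      have "(a - \<rho> j > 0 \<and> a + d * x - \<rho> j > 0) \<or> (a - \<rho> j < 0 \<and> a + d * x - \<rho> j < 0)"
        using out [OF that] mem assms(1) by auto
      then have "1 - y j * x > 0" unfolding eq by (auto simp: zero_less_mult_iff mult_less_0_iff)
      then show ?thesis unfolding eq by (simp add: abs_mult real_sqrt_mult)
    qed
    have b: "a + d * x - b = - (d * (1 - x))" by (simp add: d_def algebra_simps)
    have "f (a + d * x) = 1 / (sqrt c * (sqrt (d * x) * sqrt (d * (1 - x)) * (\<Prod>j\<in>J. sqrt \<bar>a + d * x - \<rho> j\<bar>)))"
      unfolding f_def b using True d by (simp add: real_sqrt_mult sqrt_prod abs_mult)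
    also have "(\<Prod>j\<in>J. sqrt \<bar>a + d * x - \<rho> j\<bar>) = (\<Prod>j\<in>J. sqrt \<bar>a - \<rho> j\<bar>) * (\<Prod>j\<in>J. sqrt (1 - y j * x))"
      using lin by (simp add: prod.distrib)
    also have "sqrt (d * x) * sqrt (d * (1 - x)) = d * (sqrt x * sqrt (1 - x))"
      using d by (simp add: real_sqrt_mult)
    finally have "f (a + d * x) = 1 / (d * C) * (1 / sqrt x * (1 / sqrt (1 - x)) * (1 / (\<Prod>j\<in>J. sqrt (1 - y j * x))))"
      by (simp add: C_def mult_ac)
    also have "1 / (\<Prod>j\<in>J. sqrt (1 - y j * x)) = (\<Prod>j\<in>J. 1 / sqrt (1 - y j * x))"
      by (simp add: prod_dividef)
    also have "\<dots> = (\<Prod>j\<in>J. (1 - y j * x) powr (- (1/2)))"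
      using lin by (intro prod.cong) (auto simp: half less_imp_le)
    also have "1 / sqrt x * (1 / sqrt (1 - x)) = x powr (1/2 - 1) * (1 - x) powr (1 - 1/2 - 1)"
      using True half [of x] half [of "1 - x"] by simp
    finally show ?thesis using True mem by (simp add: g_def)
  qed
  have "set_integrable lborel {0..1} g"
    unfolding g_def using y by (intro lauricella_integrable assms) auto
  then have "integrable lborel (\<lambda>x. (1 / (d * C)) * (indicator {0..1} x *\<^sub>R g x))"
    unfolding set_integrable_def by (intro integrable_mult_right) simp
  then show "set_integrable lborel {a..b} f"
    unfolding set_integrable_def pullback [symmetric]
    using lborel_integrable_real_affine_iff [of d "\<lambda>x. indicator {a..b} x *\<^sub>R f x" a] d by simp
  have "(LBINT p:{a..b}. f p) = d * (LINT x|lborel. indicator {a..b} (a + d * x) *\<^sub>R f (a + d * x))"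
    unfolding set_lebesgue_integral_def
    using lborel_integral_real_affine [of d "\<lambda>x. indicator {a..b} x *\<^sub>R f x" a] d by simp
  also have "\<dots> = d * ((1 / (d * C)) * (LBINT x:{0..1}. g x))"
    unfolding pullback set_lebesgue_integral_def by simp
  also have "\<dots> = (LBINT x:{0..1}. g x) / C"
    using d by simp
  also have "(LBINT x:{0..1}. g x) = pi * lauricella_FD (1/2) J (\<lambda>_. 1/2) 1 y"
    unfolding lauricella_FD_def g_def by (simp add: Gamma_one_half_real)
  finally show "(LBINT p:{a..b}. f p) =
      pi * lauricella_FD (1/2) J (\<lambda>_. 1/2) 1 y / (sqrt c * (\<Prod>j\<in>J. sqrt \<bar>a - \<rho> j\<bar>))"
    by (simp add: C_def)
qed

section \<open>The fibre over the lower power sums\<close>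

theorem theorem3:
  fixes n :: nat and q :: "real list"
    and R :: "real poly" and P :: "real \<Rightarrow> real poly"
    and w v r y :: "nat \<Rightarrow> real"
    and L U rminus rplus :: real
    and I :: "nat set"
  assumes "n \<ge> 5" and "length q = n - 3"
    and "R = R_poly n q"
    and "\<And>pn. P pn = power_sum_poly (0 # 1 # q @ [pn])"
    and "\<And>j. v j = poly R (w j)"
    and "L = Max {v j |j. j \<in> {1..n-1} \<and> local_min_at (poly R) (w j)}"
    and "U = Min {v j |j. j \<in> {1..n-1} \<and> local_max_at (poly R) (w j)}"
    and "\<And>j. r j = real n * (v j - gamma_shift n q)"
    and "rminus = real n * (L - gamma_shift n q)"
    and "rplus = real n * (U - gamma_shift n q)"
    and "I = {j \<in> {1..n-1}. r j \<notin> {rminus, rplus}}"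
    and "\<And>j. y j = (rplus - rminus) / (r j - rminus)"
  shows
    "(strict_mono_on {1..n-1} w \<and> (\<forall>j\<in>{1..n-1}. order (w j) (pderiv R) = 1) \<longrightarrow>
       (\<forall>pn. 0 # 1 # q @ [pn] \<in> real_rooted_points n \<longleftrightarrow> pn \<in> {rminus..rplus}) \<and>
       (L > U \<longrightarrow> {rminus..rplus} = {}) \<and>
       (\<forall>pn. \<bar>Disc (P pn)\<bar> = real n * (\<Prod>j=1..n-1. \<bar>pn - r j\<bar>)) \<and>
       (rminus < rplus \<and> card I = n - 3 \<longrightarrow>
         (\<forall>j\<in>I. y j < 1) \<and>
         set_integrable lborel {rminus..rplus} (\<lambda>pn. 1 / sqrt (Disc (P pn))) \<and>
         (LBINT pn:{rminus..rplus}. 1 / sqrt (Disc (P pn))) =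
           pi * lauricella_FD (1/2) I (\<lambda>_. 1/2) 1 y
             / (sqrt (real n) * (\<Prod>j\<in>I. sqrt \<bar>rminus - r j\<bar>)))) \<and>
     (size (proots (pderiv R)) < n - 1 \<longrightarrow>
       {pn. 0 # 1 # q @ [pn] \<in> real_rooted_points n} = {})"
proof -
  note n = assms(1) and P_def = assms(4) and r_def = assms(8)
  define m where "m = n - 1"
  have m: "n = Suc m" "m \<ge> 4" using n by (auto simp: m_def)
  have P_eq: "P p = R - [:p / real n + gamma_shift n q:]" for p
    using power_sum_poly_eq_R_poly [of n q p] assms(1-3) by (simp add: P_def)
  have P: "lead_coeff (P p) = 1" "degree (P p) = n" for p
    using has_power_sums_power_sum_poly [of "0 # 1 # q @ [p]"] assms(1,2)
    by (auto simp: has_power_sums_def P_def)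
  have P': "pderiv (P p) = pderiv R" for p
    by (simp add: P_eq pderiv_diff pderiv_pCons)
  have P_w: "poly (P p) (w j) = (r j - p) / real n" for p j
    using n by (simp add: P_eq r_def assms(5) field_simps)
  have real_rooted: "0 # 1 # q @ [p] \<in> real_rooted_points n \<longleftrightarrow> size (proots (P p)) = degree (P p)" for p
  proof -
    have "length (0 # 1 # q @ [p]) = n" using assms(1,2) by auto
    then show ?thesis by (simp add: real_rooted_points_def P flip: P_def)
  qed
  have R': "degree (pderiv R) = m" "lead_coeff (pderiv R) = real n"
  proof -
    show deg: "degree (pderiv R) = m"
      unfolding P' [of 0, symmetric] degree_pderiv P m_def ..
    show "lead_coeff (pderiv R) = real n"
      unfolding deg unfolding P' [of 0, symmetric] coeff_pderiv using P [of 0] m(1) by simp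
  qed
  have "{p. 0 # 1 # q @ [p] \<in> real_rooted_points n} = {}" if "size (proots (pderiv R)) < n - 1"
  proof -
    have False if "size (proots (P p)) = degree (P p)" for p
    proof -
      have "P p \<noteq> 0" using P(1) [of p] by auto
      from real_rooted_pderiv [OF this that] show False
        using \<open>size (proots (pderiv R)) < n - 1\<close> R'(1) m_def by (simp add: P')
    qed
    then show ?thesis unfolding real_rooted by auto
  qed
  moreover
  have "(\<forall>pn. 0 # 1 # q @ [pn] \<in> real_rooted_points n \<longleftrightarrow> pn \<in> {rminus..rplus}) \<and>
       (L > U \<longrightarrow> {rminus..rplus} = {}) \<and>
       (\<forall>pn. \<bar>Disc (P pn)\<bar> = real n * (\<Prod>j=1..n-1. \<bar>pn - r j\<bar>)) \<and>
       (rminus < rplus \<and> card I = n - 3 \<longrightarrow>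
         (\<forall>j\<in>I. y j < 1) \<and>
         set_integrable lborel {rminus..rplus} (\<lambda>pn. 1 / sqrt (Disc (P pn))) \<and>
         (LBINT pn:{rminus..rplus}. 1 / sqrt (Disc (P pn))) =
           pi * lauricella_FD (1/2) I (\<lambda>_. 1/2) 1 y
             / (sqrt (real n) * (\<Prod>j\<in>I. sqrt \<bar>rminus - r j\<bar>)))"
    if w: "strict_mono_on {1..n-1} w \<and> (\<forall>j\<in>{1..n-1}. order (w j) (pderiv R) = 1)"
  proof -
    have mono: "strict_mono_on {1..m} w" using w by (simp add: m_def)
    have R'_ne: "pderiv R \<noteq> 0" using R' n by auto
    have R'_w: "poly (pderiv R) (w j) = 0" if "j \<in> {1..m}" for j
    proof -
      have "order (w j) (pderiv R) = 1" using w that by (simp add: m_def)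
      then show ?thesis by (simp add: order_root)
    qed
    have R'_eq: "pderiv R = smult (real n) (\<Prod>j=1..m. [:-w j, 1:])"
      using eq_prod_linear_factors [OF R'_ne strict_mono_on_imp_inj_on [OF mono]] R'_w R' by simp

    \<comment> \<open>The critical points alternate and the last one is a minimum, so the parity of \<open>m - j\<close>
      decides the type of \<open>w j\<close>.\<close>
    define mins where "mins = {j \<in> {1..m}. even (m - j)}"
    define maxs where "maxs = {j \<in> {1..m}. odd (m - j)}"
    have extremum: "local_min_at (poly R) (w j) \<longleftrightarrow> even (m - j)"
      "local_max_at (poly R) (w j) \<longleftrightarrow> odd (m - j)" if "j \<in> {1..m}" for j
    proof -
      have "(-1) ^ (m - j) * poly (pderiv (pderiv R)) (w j) > 0"
        using pderiv_at_simple_root_sign [OF mono that, of "real n"] n by (simp add: R'_eq)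
      then have "(0 < poly (pderiv (pderiv R)) (w j) \<longleftrightarrow> even (m - j)) \<and>
          (poly (pderiv (pderiv R)) (w j) < 0 \<longleftrightarrow> odd (m - j)) \<and> poly (pderiv (pderiv R)) (w j) \<noteq> 0"
        by (cases "even (m - j)") auto
      then show "local_min_at (poly R) (w j) \<longleftrightarrow> even (m - j)"
        "local_max_at (poly R) (w j) \<longleftrightarrow> odd (m - j)"
        using local_extremum_iff [OF R'_w [OF that]] by simp_all
    qed
    have L: "L = Max (v ` mins)"
      unfolding assms(6) using extremum by (intro arg_cong [where f = Max]) (auto simp: mins_def m_def)
    have U: "U = Min (v ` maxs)"
      unfolding assms(7) using extremum by (intro arg_cong [where f = Min]) (auto simp: maxs_def m_def)
    have "finite mins" "finite maxs" by (auto simp: mins_def maxs_def)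
    have "m \<in> mins" "m - 1 \<in> maxs" using m by (auto simp: mins_def maxs_def)
    \<comment> \<open>The affine map \<open>t \<mapsto> n (t - \<gamma>)\<close> takes levels of \<open>R\<close> to values of the last power sum.\<close>
    have r_le: "r j \<le> p \<longleftrightarrow> v j \<le> p / real n + gamma_shift n q" for j p
      using n by (simp add: r_def field_simps)
    have r_ge: "p \<le> r j \<longleftrightarrow> p / real n + gamma_shift n q \<le> v j" for j p
      using n by (simp add: r_def field_simps)
    have "rminus \<le> p \<longleftrightarrow> L \<le> p / real n + gamma_shift n q" for p
      using n by (simp add: assms(9) field_simps)
    then have rminus_le: "rminus \<le> p \<longleftrightarrow> (\<forall>j\<in>mins. r j \<le> p)" for p
      unfolding L r_le using \<open>finite mins\<close> \<open>m \<in> mins\<close> by (subst (asm) Max_le_iff) auto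
    have "p \<le> rplus \<longleftrightarrow> p / real n + gamma_shift n q \<le> U" for p
      using n by (simp add: assms(10) field_simps)
    then have le_rplus: "p \<le> rplus \<longleftrightarrow> (\<forall>j\<in>maxs. p \<le> r j)" for p
      unfolding U r_ge using \<open>finite maxs\<close> \<open>m - 1 \<in> maxs\<close> by (subst (asm) Min_ge_iff) auto

    have fibre: "0 # 1 # q @ [p] \<in> real_rooted_points n \<longleftrightarrow> p \<in> {rminus..rplus}" for p
    proof -
      have "(-1) ^ (m - j) * poly (P p) (w j) \<le> 0 \<longleftrightarrow> (if even (m - j) then r j \<le> p else p \<le> r j)" for j
        using n by (simp add: P_w divide_le_0_iff)
      moreover have "size (proots (P p)) = degree (P p) \<longleftrightarrow>
          (\<forall>j\<in>{1..m}. (-1) ^ (m - j) * poly (P p) (w j) \<le> 0)"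
        using P [of p] m n R'_eq P' [of p]
        by (intro real_rooted_iff_signs_at_critical_points [OF _ _ _ mono]) auto
      ultimately show ?thesis
        unfolding real_rooted atLeastAtMost_iff rminus_le le_rplus by (auto simp: mins_def maxs_def)
    qed

    have disc: "\<bar>Disc (P p)\<bar> = real n * (\<Prod>j=1..m. \<bar>p - r j\<bar>)" for p
    proof -
      have "\<bar>Disc (P p)\<bar> = real n ^ n * (\<Prod>j=1..m. \<bar>poly (P p) (w j)\<bar>)"
        using abs_Disc_eq_prod_critical_values [OF P(1) [of p], of "real n" w "{1..m}"]
        by (simp add: P P' R'_eq)
      also have "(\<Prod>j=1..m. \<bar>poly (P p) (w j)\<bar>) = (\<Prod>j=1..m. \<bar>p - r j\<bar>) / real n ^ m"
        by (simp add: P_w prod_dividef abs_minus_commute)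
      finally show ?thesis using m by simp
    qed

    have "(\<forall>j\<in>I. y j < 1) \<and>
        set_integrable lborel {rminus..rplus} (\<lambda>pn. 1 / sqrt (Disc (P pn))) \<and>
        (LBINT pn:{rminus..rplus}. 1 / sqrt (Disc (P pn))) =
          pi * lauricella_FD (1/2) I (\<lambda>_. 1/2) 1 y / (sqrt (real n) * (\<Prod>j\<in>I. sqrt \<bar>rminus - r j\<bar>))"
      if less: "rminus < rplus" and card: "card I = n - 3"
    proof -
      have "L \<in> v ` mins" unfolding L using \<open>finite mins\<close> \<open>m \<in> mins\<close> by (intro Max_in) auto
      then obtain k where k: "k \<in> mins" "r k = rminus" by (auto simp: r_def assms(9))
      have "U \<in> v ` maxs" unfolding U using \<open>finite maxs\<close> \<open>m - 1 \<in> maxs\<close> by (intro Min_in) auto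
      then obtain l where l: "l \<in> maxs" "r l = rplus" by (auto simp: r_def assms(10))
      have kl: "k \<in> {1..m}" "l \<in> {1..m}" "k \<noteq> l" using k l less by (auto simp: mins_def maxs_def)
      \<comment> \<open>The hypothesis on the cardinality says that each of the two extreme critical values is taken
        only once, so the discriminant has a simple zero at each end of the interval.\<close>
      have I: "I = {1..m} - {k, l}"
      proof (rule card_subset_eq)
        show "I \<subseteq> {1..m} - {k, l}" using k l by (auto simp: assms(11) m_def)
        have "card ({1..m} - {k, l}) = m - 2" using kl by (subst card_Diff_subset) auto
        then show "card I = card ({1..m} - {k, l})" using card m by simp
      qed simp
      have out: "r j < rminus \<or> rplus < r j" if "j \<in> I" for j
      proof -
        have "j \<in> mins \<or> j \<in> maxs" "r j \<noteq> rminus" "r j \<noteq> rplus"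
          using that by (auto simp: assms(11) mins_def maxs_def m_def)
        then show ?thesis using rminus_le [of rminus] le_rplus [of rplus] by force
      qed
      have split: "(\<Prod>j=1..m. \<bar>p - r j\<bar>) = \<bar>p - rminus\<bar> * \<bar>p - rplus\<bar> * (\<Prod>j\<in>I. \<bar>p - r j\<bar>)" for p
      proof -
        have "{1..m} = insert k (insert l I)" unfolding I using kl by auto
        moreover have "k \<notin> insert l I" "l \<notin> I" "finite I" using kl by (auto simp: I)
        ultimately show ?thesis using k l by (simp add: mult.assoc)
      qed
      \<comment> \<open>Inside the fibre the discriminant is its absolute value, because all roots are real.\<close>
      have Disc_eq: "1 / sqrt (Disc (P p)) =
          1 / sqrt (real n * (\<bar>p - rminus\<bar> * \<bar>p - rplus\<bar> * (\<Prod>j\<in>I. \<bar>p - r j\<bar>)))"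
        if "p \<in> {rminus..rplus}" for p
      proof -
        have "Disc (P p) \<ge> 0"
          using fibre that real_rooted P by (intro Disc_nonneg_if_real_rooted) auto
        then show ?thesis using disc [of p] split by simp
      qed
      have y: "y = (\<lambda>j. (rplus - rminus) / (r j - rminus))" using assms(12) by auto
      have "real n > 0" "finite I" using n by (auto simp: I)
      note integral = integral_inverse_sqrt_prod_linear
        [where c = "real n" and \<rho> = r, OF less this out]
      have "\<forall>j\<in>I. y j < 1"
        unfolding y using integral(1) by blast
      moreover have "set_integrable lborel {rminus..rplus} (\<lambda>p. 1 / sqrt (Disc (P p)))"
        using integral(2) by (subst set_integrable_cong [OF refl refl Disc_eq]) auto
      moreover have "(LBINT p:{rminus..rplus}. 1 / sqrt (Disc (P p))) =
          pi * lauricella_FD (1/2) I (\<lambda>_. 1/2) 1 y / (sqrt (real n) * (\<Prod>j\<in>I. sqrt \<bar>rminus - r j\<bar>))"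
        unfolding y using integral(3) Disc_eq
        by (subst set_lebesgue_integral_cong [where g = "\<lambda>p. 1 / sqrt (real n * (\<bar>p - rminus\<bar> * \<bar>p - rplus\<bar> * (\<Prod>j\<in>I. \<bar>p - r j\<bar>)))"]) auto
      ultimately show ?thesis by blast
    qed
    moreover have "L > U \<longrightarrow> {rminus..rplus} = {}"
      using n by (simp add: assms(9,10))
    ultimately show ?thesis using fibre disc unfolding m_def by blast
  qed
  ultimately show ?thesis by blast
qed

end
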